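(* Let $M$ be a compact, connected, boundaryless smooth manifold with normalized Lebesgue volume measure $m$, and let $f : M \to M$ be a continuous map. If $f$ possesses the minimal oscillation property of Cesàro averages with respect to $m$, that is, the sequence of measures $\frac{1}{n}\sum_{i=0}^{n-1} f_*^i m$ ($n \ge 1$) has more than one accumulation point in the weak* topology, then $f$ is non-statistical with respect to $m$, that is, $m(\mathcal{NSP}(f)) > 0$.
   Context: $\mathcal{M}(M)$ denotes the space of Borel probability measures on $M$ with the weak* topology. For $x \in M$, the empirical measures along its orbit are $e_n^f(x) := \frac{1}{n}\sum_{i=0}^{n-1}\delta_{f^i(x)}$, where $\delta_y$ is the Dirac measure at $y$. The set of statistical points is $\mathcal{SP}(f) = \{x \in M : e_n^f(x) \text{ converges in the weak* topology as } n\to\infty\}$, and the set of non-statistical points is $\mathcal{NSP}(f) = M \setminus \mathcal{SP}(f)$. The map $f$ is called statistical if $m(\mathcal{NSP}(f)) = 0$ and non-statistical if $m(\mathcal{NSP}(f)) > 0$. $f_*$ denotes push-forward of measures. *)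

theory Defs
  imports "HOL-Probability.Probability"
begin

section \<open>Smooth manifolds and volume measures\<close>

text \<open>
  \<open>C_k_on k f S\<close> is meant for open \<open>S\<close>: \<open>f\<close> is of class \<open>C\<^sup>k\<close> on \<open>S\<close>, by recursion on the
  directional derivatives.
\<close>

primrec C_k_on ::
  "nat \<Rightarrow> ('e::euclidean_space \<Rightarrow> 'b::real_normed_vector) \<Rightarrow> 'e set \<Rightarrow> bool" where
  "C_k_on 0 f S \<longleftrightarrow> continuous_on S f"
| "C_k_on (Suc k) f S \<longleftrightarrow>
     (\<forall>x\<in>S. f differentiable (at x)) \<and>
     (\<forall>v. C_k_on k (\<lambda>x. frechet_derivative f (at x) v) S)"

definition smooth_on :: "('e::euclidean_space \<Rightarrow> 'b::real_normed_vector) \<Rightarrow> 'e set \<Rightarrow> bool" where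
  "smooth_on f S \<longleftrightarrow> (\<forall>k. C_k_on k f S)"

text \<open>
  The manifold is the whole type \<open>'a\<close>, Hausdorff and second countable by its type classes. A chart
  is a pair \<open>(U, \<phi>)\<close> of an open set and a homeomorphism of it onto an open subset of the model
  space \<open>'e\<close>; the values of \<open>\<phi>\<close> outside \<open>U\<close> are irrelevant. As all chart images are open in
  \<open>'e\<close>, the manifold has no boundary. The atlas need not be maximal.
\<close>

definition smooth_atlas ::
  "('a::{t2_space,second_countable_topology} set \<times> ('a \<Rightarrow> 'e::euclidean_space)) set \<Rightarrow> bool" where
  "smooth_atlas \<A> \<longleftrightarrow>
     (\<forall>(U, \<phi>)\<in>\<A>. open U \<and> open (\<phi> ` U) \<and> homeomorphism U (\<phi> ` U) \<phi> (inv_into U \<phi>)) \<and>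
     (\<Union>(U, \<phi>)\<in>\<A>. U) = UNIV \<and>
     (\<forall>(U, \<phi>)\<in>\<A>. \<forall>(V, \<psi>)\<in>\<A>. smooth_on (\<psi> \<circ> inv_into U \<phi>) (\<phi> ` (U \<inter> V)))"

text \<open>
  A smooth volume measure: in each chart it has a smooth, everywhere positive density with respect
  to Lebesgue measure. No orientation is involved.
\<close>

definition smooth_volume_measure ::
  "('a::{t2_space,second_countable_topology} set \<times> ('a \<Rightarrow> 'e::euclidean_space)) set
     \<Rightarrow> 'a measure \<Rightarrow> bool" where
  "smooth_volume_measure \<A> \<mu> \<longleftrightarrow>
     sets \<mu> = sets borel \<and>
     (\<forall>(U, \<phi>)\<in>\<A>. \<exists>\<rho>::'e \<Rightarrow> real.
        smooth_on \<rho> (\<phi> ` U) \<and> (\<forall>y\<in>\<phi> ` U. \<rho> y > 0) \<and>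
        (\<forall>B\<in>sets borel. B \<subseteq> U \<longrightarrow> emeasure \<mu> B = (\<integral>\<^sup>+y\<in>\<phi> ` B. ennreal (\<rho> y) \<partial>lborel)))"

text \<open>Normalization is the requirement of total mass one.\<close>

definition normalized_volume_measure ::
  "('a::{t2_space,second_countable_topology} set \<times> ('a \<Rightarrow> 'e::euclidean_space)) set
     \<Rightarrow> 'a measure \<Rightarrow> bool" where
  "normalized_volume_measure \<A> m \<longleftrightarrow> smooth_volume_measure \<A> m \<and> prob_space m"


section \<open>The weak* topology on Borel probability measures\<close>

definition borel_prob_measures :: "'a::topological_space measure set" where
  "borel_prob_measures = {\<mu>. sets \<mu> = sets borel \<and> prob_space \<mu>}"

text \<open>
  The coarsest topology making \<open>\<mu> \<mapsto> \<integral>g d\<mu>\<close> continuous for every continuous real function \<open>g\<close>.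
  On a compact space every such \<open>g\<close> is bounded; the definition is only meant for that case.
\<close>

definition weak_star :: "'a::topological_space measure topology" where
  "weak_star =
     pullback_topology borel_prob_measures
       (\<lambda>\<mu>. \<lambda>g\<in>{g. continuous_on UNIV g}. integral\<^sup>L \<mu> g)
       (product_topology (\<lambda>_. euclideanreal) {g. continuous_on UNIV g})"

lemma topspace_weak_star [simp]: "topspace weak_star = borel_prob_measures"
  by (auto simp: weak_star_def topspace_pullback_topology)

lemma limitin_weak_star_imp_integral:
  fixes g :: "'a::topological_space \<Rightarrow> real"
  assumes "limitin weak_star s \<mu> F" "continuous_on UNIV g"
  shows "((\<lambda>n. integral\<^sup>L (s n) g) \<longlongrightarrow> integral\<^sup>L \<mu> g) F"
proof -
  let ?C = "{g::'a \<Rightarrow> real. continuous_on UNIV g}"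
  have "continuous_map weak_star euclideanreal
      ((\<lambda>h. h g) \<circ> (\<lambda>\<mu>. \<lambda>g\<in>?C. integral\<^sup>L \<mu> g))"
    unfolding weak_star_def
    by (rule continuous_map_pullback, rule continuous_map_product_projection) (use assms(2) in simp)
  then have "limitin euclideanreal (((\<lambda>h. h g) \<circ> (\<lambda>\<mu>. \<lambda>g\<in>?C. integral\<^sup>L \<mu> g)) \<circ> s)
      (((\<lambda>h. h g) \<circ> (\<lambda>\<mu>. \<lambda>g\<in>?C. integral\<^sup>L \<mu> g)) \<mu>) F"
    by (rule continuous_map_limit) (rule assms(1))
  with assms(2) show ?thesis by (simp add: o_def)
qed

text \<open>Accumulation points of a sequence (not of its range): every neighbourhood of \<open>x\<close> contains
  \<open>s n\<close> for infinitely many \<open>n\<close>.\<close>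

definition accumulation_points :: "'b topology \<Rightarrow> (nat \<Rightarrow> 'b) \<Rightarrow> 'b set" where
  "accumulation_points X s =
     {x \<in> topspace X. \<forall>U. openin X U \<and> x \<in> U \<longrightarrow> (\<exists>\<^sub>F n in sequentially. s n \<in> U)}"


section \<open>Statistical and non-statistical maps\<close>

text \<open>The measure \<open>(1/n) \<Sum>i<n. \<nu> i\<close>; for \<open>n = 0\<close> it is the zero measure, which plays no role in
  the limits below.\<close>

definition cesaro_mean :: "(nat \<Rightarrow> 'a::topological_space measure) \<Rightarrow> nat \<Rightarrow> 'a measure" where
  "cesaro_mean \<nu> n =
     measure_of UNIV (sets borel) (\<lambda>A. ennreal (1 / real n) * (\<Sum>i<n. emeasure (\<nu> i) A))"

lemma sets_cesaro_mean [simp]: "sets (cesaro_mean \<nu> n) = sets borel"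
  unfolding cesaro_mean_def using sets.sigma_sets_eq[of borel] by simp

lemma emeasure_cesaro_mean:
  assumes "\<And>i. sets (\<nu> i) = sets borel" "A \<in> sets borel"
  shows "emeasure (cesaro_mean \<nu> n) A = ennreal (1 / real n) * (\<Sum>i<n. emeasure (\<nu> i) A)"
proof (rule emeasure_measure_of[OF cesaro_mean_def])
  show "countably_additive (sets (cesaro_mean \<nu> n))
      (\<lambda>A. ennreal (1 / real n) * (\<Sum>i<n. emeasure (\<nu> i) A))"
  proof (rule countably_additiveI)
    fix B :: "nat \<Rightarrow> 'a set"
    assume B: "range B \<subseteq> sets (cesaro_mean \<nu> n)" "disjoint_family B"
    have "(\<Sum>j. emeasure (\<nu> i) (B j)) = emeasure (\<nu> i) (\<Union>j. B j)" for i
      using B assms(1) by (intro suminf_emeasure) auto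
    then show "(\<Sum>j. ennreal (1 / real n) * (\<Sum>i<n. emeasure (\<nu> i) (B j))) =
        ennreal (1 / real n) * (\<Sum>i<n. emeasure (\<nu> i) (\<Union>j. B j))"
      by (simp add: ennreal_suminf_cmult suminf_sum summableI)
  qed
qed (use assms in \<open>auto simp: positive_def\<close>)

definition empirical_measure :: "('a::topological_space \<Rightarrow> 'a) \<Rightarrow> nat \<Rightarrow> 'a \<Rightarrow> 'a measure" where
  "empirical_measure f n x = cesaro_mean (\<lambda>i. return borel ((f ^^ i) x)) n"

definition statistical_points :: "('a::topological_space \<Rightarrow> 'a) \<Rightarrow> 'a set" where
  "statistical_points f =
     {x. \<exists>\<mu>. limitin weak_star (\<lambda>n. empirical_measure f n x) \<mu> sequentially}"

definition nonstatistical_points :: "('a::topological_space \<Rightarrow> 'a) \<Rightarrow> 'a set" where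
  "nonstatistical_points f = UNIV - statistical_points f"

text \<open>Since \<^const>\<open>emeasure\<close> is zero off the \<open>\<sigma>\<close>-algebra, this includes that the set of
  non-statistical points is measurable.\<close>

definition nonstatistical :: "'a::topological_space measure \<Rightarrow> ('a \<Rightarrow> 'a) \<Rightarrow> bool" where
  "nonstatistical m f \<longleftrightarrow> emeasure m (nonstatistical_points f) > 0"

definition minimal_oscillation :: "'a::topological_space measure \<Rightarrow> ('a \<Rightarrow> 'a) \<Rightarrow> bool" where
  "minimal_oscillation m f \<longleftrightarrow>
     (\<exists>\<mu> \<nu>. \<mu> \<noteq> \<nu> \<and>
        \<mu> \<in> accumulation_points weak_star (cesaro_mean (\<lambda>i. distr m borel (f ^^ i))) \<and>
        \<nu> \<in> accumulation_points weak_star (cesaro_mean (\<lambda>i. distr m borel (f ^^ i))))"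

text \<open>
  The class \<^class>\<open>euclidean_space\<close> excludes dimension zero. A connected manifold of dimension zero
  is a single point, where minimal oscillation is impossible:
\<close>

lemma not_minimal_oscillation_singleton:
  fixes p :: "'a::topological_space" and m :: "'a measure"
  assumes "UNIV = {p}"
  shows "\<not> minimal_oscillation m f"
proof -
  have "\<mu> = \<nu>" if "\<mu> \<in> borel_prob_measures" "\<nu> \<in> borel_prob_measures" for \<mu> \<nu> :: "'a measure"
  proof (rule measure_eqI)
    show "sets \<mu> = sets \<nu>"
      using that by (simp add: borel_prob_measures_def)
    fix A :: "'a set"
    have sp: "space \<mu> = UNIV" "space \<nu> = UNIV"
      using that sets_eq_imp_space_eq[of _ "borel :: 'a measure"]
      by (auto simp: borel_prob_measures_def)
    have "A = {} \<or> A = UNIV"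
      using assms subset_singletonD[of A p] by auto
    then show "emeasure \<mu> A = emeasure \<nu> A"
      using that sp prob_space.emeasure_space_1[of \<mu>] prob_space.emeasure_space_1[of \<nu>]
      by (auto simp: borel_prob_measures_def)
  qed
  moreover have "accumulation_points weak_star s \<subseteq> borel_prob_measures"
    for s :: "nat \<Rightarrow> 'a measure"
    by (auto simp: accumulation_points_def)
  ultimately show ?thesis
    unfolding minimal_oscillation_def by (meson subsetD)
qed

end

theory Submission
  imports Defs
begin

text \<open>
  If almost every point were statistical, dominated convergence would make the integrals of every
  continuous \<open>g\<close> against the averaged push-forwards of \<open>m\<close> converge, so that all accumulation
  points integrate \<open>g\<close> equally and hence coincide.

  The set of statistical points must also be shown to be Borel. It is the set where the Birkhoff
  averages of all continuous \<open>g\<close> converge, a condition needed only for countably many \<open>g\<close>. That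
  such convergence already yields a limit measure is a compactness statement; it is transferred from
  Helly's selection theorem on the real line by a Borel injection \<open>M \<rightarrow> \<real>\<close> whose inverse extends
  continuously to the closure of the image.
\<close>

section \<open>Integrals of Cesaro means\<close>

text \<open>The mean is the mixture of the \<nu> i under a uniformly chosen index. In this form
  integrals against it follow from the integral formula for \<open>bind\<close>. Positivity of
  \<open>n\<close> makes the index set non-empty, as a uniform distribution requires.\<close>

lemma cesaro_mean_eq_bind:
  assumes "n > 0" "\<And>i. \<nu> i \<in> borel_prob_measures"
  shows "cesaro_mean \<nu> n = measure_pmf (pmf_of_set {..<n}) \<bind> \<nu>"
proof (rule measure_eqI)
  have N: "\<nu> \<in> measure_pmf (pmf_of_set {..<n}) \<rightarrow>\<^sub>M subprob_algebra borel"
    using assms(2)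
    by (auto simp: borel_prob_measures_def space_subprob_algebra prob_space_imp_subprob_space)
  show "sets (cesaro_mean \<nu> n) = sets (measure_pmf (pmf_of_set {..<n}) \<bind> \<nu>)"
    by (simp add: sets_bind[OF sets_kernel[OF N]])
  fix A assume "A \<in> sets (cesaro_mean \<nu> n)"
  then have A: "A \<in> sets borel" by simp
  have "emeasure (measure_pmf (pmf_of_set {..<n}) \<bind> \<nu>) A
      = (\<Sum>i<n. emeasure (\<nu> i) A) / of_nat n"
    using assms(1) by (subst emeasure_bind[OF _ N A], simp, subst nn_integral_pmf_of_set)
      (auto simp: ennreal_of_nat_eq_real_of_nat)
  also have "\<dots> = ennreal (1 / real n) * (\<Sum>i<n. emeasure (\<nu> i) A)"
    using assms(1) by (simp add: divide_ennreal_def inverse_ennreal ennreal_of_nat_eq_real_of_nat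
        mult.commute inverse_eq_divide)
  also have "\<dots> = emeasure (cesaro_mean \<nu> n) A"
    using assms(2) A by (subst emeasure_cesaro_mean) (auto simp: borel_prob_measures_def)
  finally show "emeasure (cesaro_mean \<nu> n) A = emeasure (measure_pmf (pmf_of_set {..<n}) \<bind> \<nu>) A"
    by simp
qed

lemma integral_cesaro_mean:
  fixes g :: "'a::topological_space \<Rightarrow> real"
  assumes "n > 0" "\<And>i. \<nu> i \<in> borel_prob_measures"
    and "g \<in> borel_measurable borel" "\<And>x. \<bar>g x\<bar> \<le> B"
  shows "integral\<^sup>L (cesaro_mean \<nu> n) g = (\<Sum>i<n. integral\<^sup>L (\<nu> i) g) / real n"
proof -
  have N: "\<nu> \<in> measure_pmf (pmf_of_set {..<n}) \<rightarrow>\<^sub>M subprob_algebra borel"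
    using assms(2)
    by (auto simp: borel_prob_measures_def space_subprob_algebra prob_space_imp_subprob_space)
  have "emeasure (\<nu> i) (space (\<nu> i)) \<le> ennreal 1" for i
    using assms(2)[of i] by (simp add: borel_prob_measures_def prob_space.emeasure_space_1)
  then have "integral\<^sup>L (measure_pmf (pmf_of_set {..<n}) \<bind> \<nu>) g
      = (\<integral>i. integral\<^sup>L (\<nu> i) g \<partial>measure_pmf (pmf_of_set {..<n}))"
    using assms(3,4) N by (intro integral_bind[where K=borel and B=B and B'=1])
      (auto simp: measure_pmf.finite_measure_axioms)
  also have "\<dots> = (\<Sum>i<n. integral\<^sup>L (\<nu> i) g) / real n"
    using assms(1) by (subst integral_pmf_of_set) auto
  finally show ?thesis
    by (simp add: cesaro_mean_eq_bind[OF assms(1,2)])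
qed

lemma cesaro_mean_in_borel_prob_measures:
  assumes "n > 0" "\<And>i. \<nu> i \<in> borel_prob_measures"
  shows "cesaro_mean \<nu> n \<in> borel_prob_measures"
proof -
  have sp: "space (cesaro_mean \<nu> n) = UNIV"
    using sets_eq_imp_space_eq[OF sets_cesaro_mean] by simp
  have "emeasure (\<nu> i) UNIV = 1" for i
    using assms(2)[of i] prob_space.emeasure_space_1[of "\<nu> i"]
      sets_eq_imp_space_eq[of "\<nu> i" borel] by (simp add: borel_prob_measures_def)
  then have "emeasure (cesaro_mean \<nu> n) (space (cesaro_mean \<nu> n)) = 1"
    using assms unfolding sp
    by (subst emeasure_cesaro_mean)
      (auto simp: borel_prob_measures_def ennreal_of_nat_eq_real_of_nat ennreal_mult[symmetric])
  then show ?thesis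
    by (auto simp: borel_prob_measures_def intro: prob_spaceI)
qed

lemma return_in_borel_prob_measures [simp]: "return borel x \<in> borel_prob_measures"
  by (simp add: borel_prob_measures_def prob_space_return)

lemma integral_empirical_measure:
  fixes g :: "'a::topological_space \<Rightarrow> real"
  assumes "n > 0" "g \<in> borel_measurable borel" "\<And>x. \<bar>g x\<bar> \<le> B"
  shows "integral\<^sup>L (empirical_measure f n x) g = (\<Sum>i<n. g ((f ^^ i) x)) / real n"
  unfolding empirical_measure_def using assms
  by (subst integral_cesaro_mean) (auto simp: integral_return)

text \<open>The topology is pulled back from a product, so convergence is coordinatewise. The
  assumption is only eventual because the Cesaro mean at index 0 is the zero measure, which lies
  outside the space.\<close>

lemma limitin_weak_star_iff:
  fixes s :: "'b \<Rightarrow> 'a::topological_space measure"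
  assumes "\<forall>\<^sub>F n in F. s n \<in> borel_prob_measures"
  shows "limitin weak_star s \<mu> F \<longleftrightarrow> \<mu> \<in> borel_prob_measures \<and>
    (\<forall>g::'a \<Rightarrow> real. continuous_on UNIV g \<longrightarrow> ((\<lambda>n. integral\<^sup>L (s n) g) \<longlongrightarrow> integral\<^sup>L \<mu> g) F)"
proof (intro iffI conjI)
  assume "limitin weak_star s \<mu> F"
  then show "\<mu> \<in> borel_prob_measures"
    using limitin_topspace by fastforce
next
  assume "limitin weak_star s \<mu> F"
  then show "\<forall>g::'a \<Rightarrow> real. continuous_on UNIV g \<longrightarrow> ((\<lambda>n. integral\<^sup>L (s n) g) \<longlongrightarrow> integral\<^sup>L \<mu> g) F"
    using limitin_weak_star_imp_integral by blast
next
  let ?C = "{g::'a \<Rightarrow> real. continuous_on UNIV g}"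
  let ?I = "\<lambda>\<mu>. \<lambda>g\<in>?C. integral\<^sup>L \<mu> g"
  assume R: "\<mu> \<in> borel_prob_measures \<and>
    (\<forall>g::'a \<Rightarrow> real. continuous_on UNIV g \<longrightarrow> ((\<lambda>n. integral\<^sup>L (s n) g) \<longlongrightarrow> integral\<^sup>L \<mu> g) F)"
  then have L: "limitin (product_topology (\<lambda>_. euclideanreal) ?C) (\<lambda>n. ?I (s n)) (?I \<mu>) F"
    by (auto simp: limitin_componentwise)
  show "limitin weak_star s \<mu> F"
    unfolding limitin_def topspace_weak_star
  proof (intro conjI allI impI)
    fix U assume "openin weak_star U \<and> \<mu> \<in> U"
    then obtain V where V: "openin (product_topology (\<lambda>_. euclideanreal) ?C) V"
        "U = ?I -` V \<inter> borel_prob_measures" "?I \<mu> \<in> V"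
      unfolding weak_star_def openin_pullback_topology by auto
    show "\<forall>\<^sub>F n in F. s n \<in> U"
      using limitinD[OF L V(1,3)] assms by eventually_elim (auto simp: V(2))
  qed (use R in auto)
qed

section \<open>Continuous functions on a compact second countable space\<close>

lemma continuous_on_compact_UNIV_bounded:
  fixes g :: "'a::topological_space \<Rightarrow> real"
  assumes "compact (UNIV :: 'a set)" "continuous_on UNIV g"
  obtains B where "\<And>x. \<bar>g x\<bar> \<le> B"
proof -
  have "bounded (range g)"
    using assms by (simp add: compact_continuous_image compact_imp_bounded)
  then obtain B where "\<And>x. \<bar>g x\<bar> \<le> B"
    by (auto simp: bounded_iff)
  then show ?thesis
    by (rule that)
qed

lemma Urysohn_compact_point:
  fixes U :: "'a::t2_space set"
  assumes "compact (UNIV :: 'a set)" "open U" "x \<in> U"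
  obtains g :: "'a \<Rightarrow> real" where "continuous_on UNIV g" "range g \<subseteq> {0..1}"
    "g x = 1" "\<And>y. y \<notin> U \<Longrightarrow> g y = 0"
proof -
  have "Hausdorff_space (euclidean :: 'a topology)"
    unfolding Hausdorff_space_def using hausdorff by (fastforce simp: disjnt_def)
  moreover have "compact_space (euclidean :: 'a topology)"
    using assms(1) by (simp add: compact_space_def)
  ultimately have "normal_space (euclidean :: 'a topology)"
    by (simp add: compact_Hausdorff_or_regular_imp_normal_space)
  moreover have "closedin euclidean (- U)" "closedin euclidean {x}" "disjnt (- U) {x}"
    using assms by (auto simp: disjnt_def)
  ultimately obtain g where g: "continuous_map euclidean (top_of_set {0..1::real}) g"
      "g ` (- U) \<subseteq> {0}" "g ` {x} \<subseteq> {1}"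
    by (rule Urysohn_lemma[of _ _ _ 0 1]) auto
  show ?thesis
    using g by (intro that[of g]) (auto simp: continuous_map_in_subtopology)
qed

text \<open>U is a countable union of basic open sets, each carrying a continuous function that is 1
  on it and 0 off U. These countably many functions are combined into one increasing
  sequence.\<close>

lemma indicator_open_limit_continuous:
  fixes U :: "'a::{t2_space,second_countable_topology} set"
  assumes "compact (UNIV :: 'a set)" "open U"
  obtains g :: "nat \<Rightarrow> 'a \<Rightarrow> real" where "\<And>n. continuous_on UNIV (g n)"
    "\<And>n x. \<bar>g n x\<bar> \<le> 1" "\<And>x. (\<lambda>n. g n x) \<longlonglongrightarrow> indicator U x"
proof -
  obtain \<B> :: "'a set set" where \<B>: "countable \<B>" "topological_basis \<B>"
    using ex_countable_basis by blast
  define P where "P b \<phi> \<longleftrightarrow> continuous_on UNIV \<phi> \<and> range \<phi> \<subseteq> {0..1::real} \<and>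
      (\<forall>y\<in>b. \<phi> y = 1) \<and> (\<forall>y. y \<notin> U \<longrightarrow> \<phi> y = 0)" for b and \<phi> :: "'a \<Rightarrow> real"
  \<comment> \<open>The empty set, served by the zero function, keeps the family non-empty so that
    it can be enumerated.\<close>
  define \<C> where "\<C> = insert {} {b\<in>\<B>. \<exists>\<phi>. P b \<phi>}"
  have "countable \<C>" "\<C> \<noteq> {}"
    using \<B>(1) by (auto simp: \<C>_def)
  then have rC: "range (from_nat_into \<C>) = \<C>"
    by (rule range_from_nat_into[rotated])
  have "P {} (\<lambda>_. 0)" by (simp add: P_def)
  then have "\<forall>b\<in>\<C>. \<exists>\<phi>. P b \<phi>" by (auto simp: \<C>_def)
  then have "\<forall>n. \<exists>\<phi>. P (from_nat_into \<C> n) \<phi>" using rC by blast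
  then obtain \<phi> where \<phi>: "\<And>n. P (from_nat_into \<C> n) (\<phi> n)" by metis
  have cover: "\<exists>n. x \<in> from_nat_into \<C> n" if x: "x \<in> U" for x
  proof -
    obtain u :: "'a \<Rightarrow> real" where u: "continuous_on UNIV u" "range u \<subseteq> {0..1}"
        "u x = 1" "\<And>y. y \<notin> U \<Longrightarrow> u y = 0"
      using Urysohn_compact_point[OF assms x] by metis
    have "open (u -` {1/2<..})"
      using u(1) by (rule open_vimage[rotated]) simp
    then obtain b where b: "b \<in> \<B>" "x \<in> b" "b \<subseteq> u -` {1/2<..}"
      using topological_basisE[OF \<B>(2), of "u -` {1/2<..}" x] u(3) by auto
    \<comment> \<open>A Urysohn function is 1 only at x itself; since it exceeds 1/2 on
      \<open>b\<close>, doubling and truncating it gives 1 on all of \<open>b\<close>.\<close>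
    have "P b (\<lambda>y. min 1 (2 * u y))"
      unfolding P_def
    proof (intro conjI ballI allI impI)
      show "continuous_on UNIV (\<lambda>y. min 1 (2 * u y))"
        using u(1) by (intro continuous_intros)
      show "range (\<lambda>y. min 1 (2 * u y)) \<subseteq> {0..1}"
        using u(2) by auto
      show "min 1 (2 * u y) = 1" if "y \<in> b" for y
        using subsetD[OF b(3) that] by simp
      show "min 1 (2 * u y) = 0" if "y \<notin> U" for y
        using u(4)[OF that] by simp
    qed
    then have "b \<in> \<C>" using b(1) by (auto simp: \<C>_def)
    then show ?thesis using b(2) rC by (metis rangeE)
  qed
  \<comment> \<open>The product vanishes as soon as one \<phi> i x is 1, which happens eventually
    for every x in U; off U all its factors are 1.\<close>
  define g where "g n x = 1 - (\<Prod>i<n. 1 - \<phi> i x)" for n x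
  have \<phi>01: "0 \<le> \<phi> i x" "\<phi> i x \<le> 1" for i x
    using \<phi>[of i] by (auto simp: P_def image_subset_iff)
  have "continuous_on UNIV (g n)" for n
    unfolding g_def using \<phi> by (intro continuous_intros) (auto simp: P_def)
  moreover have "\<bar>g n x\<bar> \<le> 1" for n x
  proof -
    have "0 \<le> (\<Prod>i<n. 1 - \<phi> i x)" "(\<Prod>i<n. 1 - \<phi> i x) \<le> 1"
      using \<phi>01 by (auto intro!: prod_nonneg prod_le_1)
    then show ?thesis by (simp add: g_def)
  qed
  moreover have "(\<lambda>n. g n x) \<longlonglongrightarrow> indicator U x" for x
  proof (cases "x \<in> U")
    case True
    then obtain k where "x \<in> from_nat_into \<C> k" using cover by blast
    then have "\<phi> k x = 1" using \<phi>[of k] by (auto simp: P_def)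
    then have "g n x = 1" if "n > k" for n
      using that by (auto simp: g_def intro!: prod_zero)
    then show ?thesis
      using True by (intro tendsto_eventually) (auto intro: eventually_mono[OF eventually_gt_at_top[of k]])
  next
    case False
    then have "\<phi> k x = 0" for k using \<phi>[of k] by (auto simp: P_def)
    then show ?thesis using False by (simp add: g_def)
  qed
  ultimately show ?thesis by (rule that)
qed

text \<open>By dominated convergence the integrals of continuous functions determine the measure of
  each open set, and the open sets are an intersection-stable generator of the Borel sets.\<close>

lemma borel_prob_measures_eqI:
  fixes \<mu> \<nu> :: "'a::{t2_space,second_countable_topology} measure"
  assumes "compact (UNIV :: 'a set)" "\<mu> \<in> borel_prob_measures" "\<nu> \<in> borel_prob_measures"
    and "\<And>g::'a \<Rightarrow> real. continuous_on UNIV g \<Longrightarrow> integral\<^sup>L \<mu> g = integral\<^sup>L \<nu> g"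
  shows "\<mu> = \<nu>"
proof (rule measure_eqI_generator_eq[where E="{S. open S}" and \<Omega>=UNIV and A="\<lambda>_. UNIV"])
  have lim: "(\<lambda>n. integral\<^sup>L M (g n)) \<longlonglongrightarrow> measure M U"
    if M: "M \<in> borel_prob_measures" and "open U" and g: "\<And>n. continuous_on UNIV (g n)"
    "\<And>n x. \<bar>g n x\<bar> \<le> 1" "\<And>x. (\<lambda>n. g n x) \<longlonglongrightarrow> indicator U x"
    for M :: "'a measure" and U and g :: "nat \<Rightarrow> 'a \<Rightarrow> real"
  proof -
    interpret prob_space M using M by (simp add: borel_prob_measures_def)
    have [measurable_cong]: "sets M = sets borel" using M by (simp add: borel_prob_measures_def)
    have [measurable]: "g n \<in> borel_measurable M" for n
      by (subst measurable_cong_sets[OF \<open>sets M = sets borel\<close> refl])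
        (rule borel_measurable_continuous_onI[OF g(1)])
    have [measurable]: "U \<in> sets M"
      using \<open>open U\<close> \<open>sets M = sets borel\<close> by simp
    have "(\<lambda>n. integral\<^sup>L M (g n)) \<longlonglongrightarrow> integral\<^sup>L M (indicator U)"
      by (rule integral_dominated_convergence[where w="\<lambda>_. 1"]) (auto simp: g)
    then show ?thesis by simp
  qed
  show "emeasure \<mu> U = emeasure \<nu> U" if "U \<in> {S. open S}" for U
  proof -
    interpret \<mu>: prob_space \<mu> using assms(2) by (simp add: borel_prob_measures_def)
    interpret \<nu>: prob_space \<nu> using assms(3) by (simp add: borel_prob_measures_def)
    have U: "open U" using that by simp
    obtain g :: "nat \<Rightarrow> 'a \<Rightarrow> real" where g: "\<And>n. continuous_on UNIV (g n)"
        "\<And>n x. \<bar>g n x\<bar> \<le> 1" "\<And>x. (\<lambda>n. g n x) \<longlonglongrightarrow> indicator U x"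
      using indicator_open_limit_continuous[OF assms(1) U] by metis
    have "measure \<mu> U = measure \<nu> U"
      using LIMSEQ_unique[OF lim[OF assms(2) U g]] lim[OF assms(3) U g] assms(4)[OF g(1)] by simp
    then show ?thesis by (simp add: \<mu>.emeasure_eq_measure \<nu>.emeasure_eq_measure)
  qed
  show "emeasure \<mu> UNIV \<noteq> \<infinity>"
    using assms(2) prob_space.emeasure_space_1[of \<mu>] sets_eq_imp_space_eq[of \<mu> borel]
    by (simp add: borel_prob_measures_def)
qed (use assms(2,3) in \<open>auto simp: borel_prob_measures_def sets_borel Int_stable_def\<close>)

text \<open>
  A continuous function is coded up to \<open>1 / (k + 1)\<close> by a finite cover by basic open sets with a
  rational value attached to each; one function is chosen for each code.
\<close>

lemma ex_countable_dense_continuous: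
  assumes "compact (UNIV :: 'a set)"
  obtains D :: "('a::second_countable_topology \<Rightarrow> real) set" where "countable D" "\<And>d. d \<in> D \<Longrightarrow> continuous_on UNIV d"
    "\<And>g e. continuous_on UNIV g \<Longrightarrow> e > 0 \<Longrightarrow> \<exists>d\<in>D. \<forall>x. \<bar>g x - d x\<bar> < e"
proof -
  obtain \<B> :: "'a set set" where \<B>: "countable \<B>" "topological_basis \<B>"
    using ex_countable_basis by blast
  define codes where "codes = {L. finite L \<and> L \<subseteq> \<B> \<times> (\<rat>::real set)} \<times> (UNIV :: nat set)"
  define P where "P c g \<longleftrightarrow> continuous_on UNIV g \<and> (\<Union>(b, q)\<in>fst c. b) = UNIV \<and>
      (\<forall>(b, q)\<in>fst c. \<forall>x\<in>b. \<bar>g x - q\<bar> < 1 / real (Suc (snd c)))"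
    for c :: "('a set \<times> real) set \<times> nat" and g :: "'a \<Rightarrow> real"
  define D where "D = (\<lambda>c. SOME g. P c g) ` {c\<in>codes. \<exists>g. P c g}"
  have someP: "P c (SOME g. P c g)" if "\<exists>g. P c g" for c
    using that by (rule someI_ex)
  show ?thesis
  proof
    have "countable codes"
      unfolding codes_def using \<B>(1)
      by (intro countable_SIGMA countable_Collect_finite_subset) (auto simp: countable_rat)
    then show "countable D" by (simp add: D_def)
  next
    fix d assume "d \<in> D"
    then show "continuous_on UNIV d" using someP by (auto simp: D_def P_def)
  next
    fix g :: "'a \<Rightarrow> real" and e :: real
    assume g: "continuous_on UNIV g" and "e > 0"
    \<comment> \<open>Half of \<open>e\<close> suffices: \<open>g\<close> and the function chosen
      for its code both lie within 1 / (k + 1) of the same rational value at each point.\<close>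
    obtain k where k: "1 / real (Suc k) < e / 2"
      using reals_Archimedean[of "e / 2"] \<open>e > 0\<close> by (auto simp: inverse_eq_divide)
    define \<delta> where "\<delta> = 1 / real (Suc k)"
    have "\<delta> > 0" by (simp add: \<delta>_def)
    have "\<exists>b q. b \<in> \<B> \<and> q \<in> \<rat> \<and> x \<in> b \<and> (\<forall>y\<in>b. \<bar>g y - q\<bar> < \<delta>)" for x
    proof -
      obtain q where q: "q \<in> \<rat>" "g x - \<delta> < q" "q < g x + \<delta>"
        using Rats_dense_in_real[of "g x - \<delta>" "g x + \<delta>"] \<open>\<delta> > 0\<close> by auto
      have "open (g -` ball q \<delta>)" using g by (rule open_vimage[rotated]) simp
      moreover have "x \<in> g -` ball q \<delta>" using q by (auto simp: dist_real_def)
      ultimately obtain b where "b \<in> \<B>" "x \<in> b" "b \<subseteq> g -` ball q \<delta>"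
        using topological_basisE[OF \<B>(2)] by metis
      then show ?thesis using q(1)
        by (intro exI[of _ b] exI[of _ q]) (force simp: dist_real_def abs_minus_commute)
    qed
    then obtain b q where bq: "\<And>x. b x \<in> \<B>" "\<And>x. q x \<in> \<rat>" "\<And>x. x \<in> b x"
        "\<And>x y. y \<in> b x \<Longrightarrow> \<bar>g y - q x\<bar> < \<delta>"
      by metis
    have "open (b x)" for x using bq(1) \<B>(2) by (auto simp: topological_basis_def)
    moreover have "UNIV \<subseteq> (\<Union>x\<in>UNIV. b x)" using bq(3) by auto
    ultimately obtain X where X: "finite X" "UNIV \<subseteq> (\<Union>x\<in>X. b x)"
      using compactE_image[OF assms, of UNIV b] by metis
    define c where "c = ((\<lambda>x. (b x, q x)) ` X, k)"
    have c: "c \<in> codes" using X(1) bq by (auto simp: c_def codes_def)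
    have Pg: "P c g"
      using X(2) bq(4) g by (auto simp: c_def P_def \<delta>_def)
    \<comment> \<open>The chosen function need not be \<open>g\<close>; sharing the code
      \<open>c\<close> with it is enough for closeness.\<close>
    define d where "d = (SOME g. P c g)"
    have Pd: "P c d" unfolding d_def using Pg by (intro someP) blast
    have "\<bar>g x - d x\<bar> < e" for x
    proof -
      have "x \<in> (\<Union>(b, q)\<in>fst c. b)" using Pg by (simp add: P_def)
      then obtain b' q' where "(b', q') \<in> fst c" "x \<in> b'" by auto
      then have "\<bar>g x - q'\<bar> < \<delta>" "\<bar>d x - q'\<bar> < \<delta>"
        using Pg Pd by (fastforce simp: P_def c_def \<delta>_def)+
      then show ?thesis using k unfolding \<delta>_def by linarith
    qed
    moreover have "d \<in> D" using c Pg by (auto simp: D_def d_def)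
    ultimately show "\<exists>d\<in>D. \<forall>x. \<bar>g x - d x\<bar> < e" by blast
  qed
qed

text \<open>At the first differing digit k the sums separate by (1/3)^k, and all later digits can
  compensate at most half of that. In base 2 the tail could cancel the leading difference entirely,
  hence base 3.\<close>

lemma ternary_digits_eq:
  fixes p q :: "nat \<Rightarrow> bool"
  assumes "\<bar>(\<Sum>i. of_bool (p i) * (1/3)^i) - (\<Sum>i. of_bool (q i) * (1/3)^i)\<bar> < (1/3)^n / (2::real)"
    and "i \<le> n"
  shows "p i \<longleftrightarrow> q i"
proof (rule ccontr)
  assume "p i \<noteq> q i"
  define k where "k = (LEAST i. p i \<noteq> q i)"
  have k: "p k \<noteq> q k" "\<And>j. j < k \<Longrightarrow> p j = q j" "k \<le> i"
    using \<open>p i \<noteq> q i\<close> unfolding k_def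
    by (rule LeastI, use not_less_Least in blast, rule Least_le)
  define c :: "nat \<Rightarrow> real" where "c j = (of_bool (p j) - of_bool (q j)) * (1/3)^j" for j
  have geo: "summable (\<lambda>j. (1/3::real)^j)" by (simp add: summable_geometric)
  have sum_bit: "summable (\<lambda>i. of_bool (r i) * (1/3::real)^i)" for r :: "nat \<Rightarrow> bool"
    by (rule summable_comparison_test'[OF geo, of 0]) auto
  have sc: "summable c"
    unfolding c_def left_diff_distrib using sum_bit by (intro summable_diff)
  have diff: "(\<Sum>i. of_bool (p i) * (1/3)^i) - (\<Sum>i. of_bool (q i) * (1/3)^i) = suminf c"
    unfolding c_def left_diff_distrib using sum_bit by (intro suminf_diff)
  \<comment> \<open>Terms before k vanish by minimality of k, so only the leading term and the tail
    remain.\<close>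
  have "suminf c = (\<Sum>j. c (j + Suc k)) + (\<Sum>j<Suc k. c j)"
    by (rule suminf_split_initial_segment[OF sc])
  also have "(\<Sum>j<Suc k. c j) = c k"
    using k(2) by (simp add: c_def)
  finally have split: "suminf c = (\<Sum>j. c (j + Suc k)) + c k" .
  have tail: "(\<lambda>j. (1/3::real)^(j + Suc k)) sums ((1/3)^k / 2)"
    using sums_mult[OF geometric_sums[of "1/3::real"], of "(1/3)^Suc k"] by (simp add: power_add field_simps)
  have "norm (\<Sum>j. c (j + Suc k)) \<le> (\<Sum>j. (1/3::real)^(j + Suc k))"
    by (rule norm_suminf_le) (auto simp: c_def sums_summable[OF tail])
  then have "\<bar>\<Sum>j. c (j + Suc k)\<bar> \<le> (1/3)^k / 2"
    using sums_unique[OF tail] by simp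
  moreover have "\<bar>c k\<bar> = (1/3)^k"
    using k(1) by (auto simp: c_def)
  ultimately have "(1/3)^k / 2 \<le> \<bar>suminf c\<bar>"
    unfolding split by linarith
  moreover have "(1/3::real)^n \<le> (1/3)^k"
    using k(3) \<open>i \<le> n\<close> by (intro power_decreasing) auto
  ultimately show False
    using assms(1) unfolding diff by linarith
qed

section \<open>Weak* limits of probability measures\<close>

text \<open>
  \<open>s x\<close> records in ternary digits which basic open sets contain \<open>x\<close>. Close codes agree in their
  first digits, so the closure of the graph of \<open>s\<^sup>-\<^sup>1\<close> is again the graph of a function, which is
  continuous because its graph is compact.
\<close>

lemma ex_real_coding:
  assumes "compact (UNIV :: 'a set)"
  obtains s :: "'a::{t2_space,second_countable_topology} \<Rightarrow> real" and h :: "real \<Rightarrow> 'a"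
  where "s \<in> borel_measurable borel" "range s \<subseteq> {0..3/2}"
    "continuous_on (closure (range s)) h" "\<And>x. h (s x) = x"
proof -
  obtain \<B> :: "'a set set" where \<B>: "countable \<B>" "topological_basis \<B>"
    using ex_countable_basis by blast
  have "\<B> \<noteq> {}"
    using topological_basisE[OF \<B>(2) open_UNIV UNIV_I] by blast
  define b where "b = from_nat_into \<B>"
  have rb: "range b = \<B>"
    unfolding b_def using \<open>\<B> \<noteq> {}\<close> \<B>(1) by (rule range_from_nat_into)
  have ob: "open (b n)" for n
    using \<B>(2) rb unfolding topological_basis_def by blast
  have nb: "\<exists>n. y \<in> b n \<and> b n \<subseteq> U" if "open U" "y \<in> U" for y U
    using topological_basisE[OF \<B>(2) that] rb by (metis rangeE)
  define s where "s x = (\<Sum>i. of_bool (x \<in> b i) * (1/3::real)^i)" for x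
  have geo: "(\<lambda>i. (1/3::real)^i) sums (3/2)"
    using geometric_sums[of "1/3::real"] by simp
  have sum_bit: "summable (\<lambda>i. of_bool (x \<in> b i) * (1/3::real)^i)" for x
    by (rule summable_comparison_test'[OF sums_summable[OF geo], of 0]) auto
  have s_range: "range s \<subseteq> {0..3/2}"
  proof safe
    fix x
    have "s x \<ge> 0"
      unfolding s_def by (intro suminf_nonneg sum_bit) simp
    moreover have "s x \<le> (\<Sum>i. (1/3::real)^i)"
      unfolding s_def by (intro suminf_le sum_bit sums_summable[OF geo]) auto
    ultimately show "s x \<in> {0..3/2}"
      using sums_unique[OF geo] by simp
  qed
  have s_meas: "s \<in> borel_measurable borel"
  proof -
    have "(\<lambda>x. indicator (b i) x * (1/3::real)^i) \<in> borel_measurable borel" for i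
      using ob[of i] by simp
    then have "(\<lambda>x. \<Sum>i. indicator (b i) x * (1/3::real)^i) \<in> borel_measurable borel"
      by (rule borel_measurable_suminf)
    then show ?thesis
      by (simp add: s_def[abs_def] indicator_def of_bool_def)
  qed
  define K where "K = closure (range s)"
  define R where "R = closure (range (\<lambda>x. (s x, x)))"
  have "R \<subseteq> {0..3/2} \<times> UNIV"
    unfolding R_def using s_range by (intro closure_minimal closed_Times) auto
  moreover have "compact ({0..3/2::real} \<times> (UNIV :: 'a set))"
    using assms by (intro compact_Times) auto
  moreover have closed_R: "closed R" by (simp add: R_def)
  ultimately have compact_R: "compact R"
    using compact_Int_closed[of "{0..3/2} \<times> UNIV" R] by (simp add: inf.absorb2)
  have graph: "(s x, x) \<in> R" for x
    unfolding R_def by (rule subsetD[OF closure_subset]) simp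
  \<comment> \<open>A rectangle around a point of the closure meets the graph; otherwise its closed
    complement would contain the closure.\<close>
  have near: "\<exists>x. s x \<in> W \<and> x \<in> V" if "(t, y) \<in> R" "open W" "t \<in> W" "open V" "y \<in> V" for t y W V
  proof (rule ccontr)
    assume "\<nexists>x. s x \<in> W \<and> x \<in> V"
    then have "range (\<lambda>x. (s x, x)) \<subseteq> - (W \<times> V)" by auto
    then have "R \<subseteq> - (W \<times> V)"
      unfolding R_def using that by (intro closure_minimal) (auto simp: closed_Compl open_Times)
    then show False using that by blast
  qed
  have unique: "y = z" if R: "(t, y) \<in> R" "(t, z) \<in> R" for t y z
  proof (rule ccontr)
    assume "y \<noteq> z"
    then obtain U V where UV: "open U" "open V" "y \<in> U" "z \<in> V" "U \<inter> V = {}"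
      using hausdorff[of y z] by auto
    obtain i where i: "y \<in> b i" "b i \<subseteq> U" using nb[OF UV(1,3)] by auto
    obtain j where j: "z \<in> b j" "b j \<subseteq> V" using nb[OF UV(2,4)] by auto
    \<comment> \<open>Two points of a ball of this radius are less than (1/3)^max i j / 2 apart, the
      threshold for agreement of the digits i and j. Then \<open>x\<close> lies in both
      \<open>b i\<close> and \<open>b j\<close>, although U and V are disjoint.\<close>
    define \<epsilon> where "\<epsilon> = (1/3::real)^max i j / 4"
    have "\<epsilon> > 0" by (simp add: \<epsilon>_def)
    then obtain x where x: "s x \<in> ball t \<epsilon>" "x \<in> b i"
      using near[OF R(1), of "ball t \<epsilon>" "b i"] i ob by auto
    obtain x' where x': "s x' \<in> ball t \<epsilon>" "x' \<in> b j"
      using near[OF R(2), of "ball t \<epsilon>" "b j"] \<open>\<epsilon> > 0\<close> j ob by auto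
    have "\<bar>s x - s x'\<bar> < (1/3)^max i j / 2"
      using x(1) x'(1) unfolding \<epsilon>_def mem_ball dist_real_def by linarith
    then have "x \<in> b j \<longleftrightarrow> x' \<in> b j"
      unfolding s_def by (rule ternary_digits_eq) simp
    then have "x' \<in> V" "x \<in> V" using x'(2) j(2) by auto
    then show False using x(2) i(2) UV(5) by auto
  qed
  \<comment> \<open>The projection of the compact set R is closed and contains the range of
    \<open>s\<close>, so every point of K has a partner in R.\<close>
  have K_fst: "K = fst ` R"
  proof
    have "compact (fst ` R)"
      using compact_R by (intro compact_continuous_image continuous_intros)
    moreover have "range s \<subseteq> fst ` R" using graph by force
    ultimately show "K \<subseteq> fst ` R"
      unfolding K_def by (intro closure_minimal compact_imp_closed)
    show "fst ` R \<subseteq> K"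
      unfolding R_def K_def
      by (intro image_closure_subset continuous_intros) (auto intro: subsetD[OF closure_subset])
  qed
  define h where "h t = (THE y. (t, y) \<in> R)" for t
  have h: "h t = y" if "(t, y) \<in> R" for t y
    unfolding h_def using that unique by blast
  have "continuous_on K h"
  proof -
    have "closed (h -` B \<inter> K)" if "closed B" for B
    proof -
      \<comment> \<open>Closed graph argument: the preimage of B is the projection of a compact part
        of R.\<close>
      have "h -` B \<inter> K = fst ` (R \<inter> UNIV \<times> B)"
        unfolding K_fst using h by (force simp: image_iff)
      moreover have "compact (R \<inter> UNIV \<times> B)"
        using compact_R that by (intro compact_Int_closed closed_Times) auto
      then have "compact (fst ` (R \<inter> UNIV \<times> B))"
        by (rule compact_continuous_image[rotated]) (intro continuous_intros)
      ultimately show ?thesis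
        by (simp add: compact_imp_closed)
    qed
    then show ?thesis
      using continuous_on_closed_vimage[of K h] by (simp add: K_def)
  qed
  moreover have "h (s x) = x" for x
    using graph by (rule h)
  ultimately show ?thesis
    using that[OF s_meas s_range] unfolding K_def by metis
qed

lemma borel_prob_measures_distr:
  assumes "M \<in> borel_prob_measures" "s \<in> borel_measurable borel"
  shows "distr M borel s \<in> borel_prob_measures"
proof -
  interpret prob_space M using assms(1) by (simp add: borel_prob_measures_def)
  have "s \<in> M \<rightarrow>\<^sub>M borel"
    using assms by (subst measurable_cong_sets[of _ borel]) (auto simp: borel_prob_measures_def)
  then show ?thesis
    by (auto simp: borel_prob_measures_def intro: prob_space_distr)
qed

lemma integral_distr_borel:
  fixes g :: "'b::topological_space \<Rightarrow> real"
  assumes "M \<in> borel_prob_measures" "s \<in> borel_measurable borel" "g \<in> borel_measurable borel"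
  shows "integral\<^sup>L (distr M borel s) g = (\<integral>x. g (s x) \<partial>M)"
  using assms by (intro integral_distr)
    (auto simp: borel_prob_measures_def cong: measurable_cong_sets)

text \<open>The images of the measures under the coding \<open>s\<close> live on a fixed bounded
  interval, so a subsequence converges weakly on the real line; its limit is carried back by
  \<open>h\<close>. One subsequence suffices because each full sequence of integrals is assumed to
  converge.\<close>

lemma convergent_integrals_imp_limit_measure:
  fixes P :: "nat \<Rightarrow> 'a::{t2_space,second_countable_topology} measure"
  assumes "compact (UNIV :: 'a set)" "\<And>n. P n \<in> borel_prob_measures"
    and conv: "\<And>g::'a \<Rightarrow> real. continuous_on UNIV g \<Longrightarrow> convergent (\<lambda>n. integral\<^sup>L (P n) g)"
  obtains \<mu> where "\<mu> \<in> borel_prob_measures"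
    "\<And>g::'a \<Rightarrow> real. continuous_on UNIV g \<Longrightarrow> (\<lambda>n. integral\<^sup>L (P n) g) \<longlonglongrightarrow> integral\<^sup>L \<mu> g"
proof -
  obtain s :: "'a \<Rightarrow> real" and h :: "real \<Rightarrow> 'a"
    where s: "s \<in> borel_measurable borel" "range s \<subseteq> {0..3/2}"
      and h: "continuous_on (closure (range s)) h" "\<And>x. h (s x) = x"
    using ex_real_coding[OF assms(1)] by metis
  define K where "K = closure (range s)"
  have sK: "s x \<in> K" for x unfolding K_def by (rule subsetD[OF closure_subset]) simp
  have [simp]: "closed K" "K \<noteq> {}" by (auto simp: K_def)
  define N where "N n = distr (P n) borel s" for n
  have N: "N n \<in> borel_prob_measures" for n
    unfolding N_def using assms(2) s(1) by (rule borel_prob_measures_distr)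
  have rdN: "real_distribution (N n)" for n
    using N[of n] by (auto simp: borel_prob_measures_def real_distribution_def real_distribution_axioms_def)
  \<comment> \<open>This interval contains [0, 3/2], hence the range of \<open>s\<close>, and so
    witnesses tightness for every \<epsilon>.\<close>
  have "measure (N n) {-1<..2} = 1" for n
  proof -
    interpret prob_space "P n" using assms(2)[of n] by (simp add: borel_prob_measures_def)
    have "s \<in> P n \<rightarrow>\<^sub>M borel"
      using assms(2)[of n] s(1)
      by (subst measurable_cong_sets[of _ borel]) (auto simp: borel_prob_measures_def)
    moreover have "s x \<in> {-1<..2}" for x
      using subsetD[OF s(2) rangeI[of s x]] by simp
    then have "s -` {-1<..2} = UNIV" by blast
    ultimately show ?thesis
      by (simp add: N_def measure_distr prob_space)
  qed
  then have "-1 < (2::real) \<and> (\<forall>n. measure (N n) {-1<..2} > 1 - \<epsilon>)" if "\<epsilon> > 0" for \<epsilon> :: real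
    using that by simp
  then have "tight N"
    unfolding tight_def using rdN by blast
  then obtain r M where r: "strict_mono r" and M: "real_distribution M"
      and wc: "weak_conv_m (N \<circ> r) M"
    using tight_imp_convergent_subsubsequence[of N id] by (auto simp: strict_mono_def)
  interpret M: real_distribution M by (rule M)
  have M': "M \<in> borel_prob_measures"
    by (simp add: borel_prob_measures_def M.prob_space_axioms)
  have lim: "(\<lambda>n. \<integral>x. G (s x) \<partial>P (r n)) \<longlonglongrightarrow> integral\<^sup>L M G"
    if G: "continuous_on UNIV G" "\<And>t. \<bar>G t\<bar> \<le> B" for G :: "real \<Rightarrow> real" and B
  proof -
    have "(\<lambda>n. integral\<^sup>L ((N \<circ> r) n) G) \<longlonglongrightarrow> integral\<^sup>L M G"
      using G rdN by (intro weak_conv_imp_integral_bdd_continuous_conv[OF _ M wc])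
        (auto simp: continuous_on_eq_continuous_at)
    moreover have "integral\<^sup>L (N n) G = (\<integral>x. G (s x) \<partial>P n)" for n
      unfolding N_def using assms(2) s(1) borel_measurable_continuous_onI[OF G(1)]
      by (rule integral_distr_borel)
    ultimately show ?thesis by simp
  qed
  \<comment> \<open>The truncated distance to K is a bounded continuous test function that vanishes
    on the range of \<open>s\<close>. Its integral against \<open>M\<close> is therefore 0, and K is
    closed.\<close>
  have AE_K: "AE t in M. t \<in> K"
  proof -
    define G where "G t = min 1 (infdist t K)" for t
    have contG: "continuous_on UNIV G"
      unfolding G_def by (intro continuous_intros)
    then have G_meas: "G \<in> borel_measurable M"
      using borel_measurable_continuous_onI by (simp cong: measurable_cong_sets)
    have G0: "G t \<ge> 0" for t by (simp add: G_def infdist_nonneg)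
    have "G (s x) = 0" for x using sK by (simp add: G_def)
    then have "integral\<^sup>L M G = 0"
      using LIMSEQ_unique[OF lim[OF contG, of 1]] G0 by (auto simp: G_def infdist_nonneg)
    moreover have "integrable M G"
      using G_meas by (intro M.integrable_const_bound[of _ 1]) (auto simp: G_def infdist_nonneg)
    ultimately have "AE t in M. G t = 0"
      using integral_nonneg_eq_0_iff_AE[of M G] G0 by auto
    then show ?thesis
      by eventually_elim (auto simp: G_def in_closed_iff_infdist_zero min_def split: if_splits)
  qed
  \<comment> \<open>\<open>h\<close> is controlled only on K. A constant value elsewhere makes the
    map Borel, and \<open>M\<close> gives the complement of K no mass.\<close>
  define h' where "h' t = (if t \<in> K then h t else undefined)" for t
  have h'_meas: "h' \<in> borel_measurable borel"
    unfolding h'_def using h(1)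
    by (intro borel_measurable_continuous_on_if) (auto simp: K_def)
  define \<mu> where "\<mu> = distr M borel h'"
  have \<mu>: "\<mu> \<in> borel_prob_measures"
    unfolding \<mu>_def using M' h'_meas by (rule borel_prob_measures_distr)
  have "(\<lambda>n. integral\<^sup>L (P n) g) \<longlonglongrightarrow> integral\<^sup>L \<mu> g" if g: "continuous_on UNIV g" for g :: "'a \<Rightarrow> real"
  proof -
    obtain B where B: "\<And>x. \<bar>g x\<bar> \<le> B"
      using continuous_on_compact_UNIV_bounded[OF assms(1) g] by blast
    \<comment> \<open>Weak convergence tests functions continuous on the whole line, so
      \<open>g\<close> composed with \<open>h\<close> is extended from K by Tietze with the same
      bound. Along \<open>s\<close> the extension gives back \<open>g\<close>.\<close>
    have "continuous_on K (\<lambda>t. g (h t))"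
      unfolding K_def using continuous_on_compose2[OF g h(1)] by auto
    then obtain G where G: "continuous_on UNIV G" "\<And>t. t \<in> K \<Longrightarrow> G t = g (h t)" "\<And>t. norm (G t) \<le> B"
      using Tietze[of K "\<lambda>t. g (h t)" UNIV B] B order_trans[OF abs_ge_zero B] by auto
    have g_meas: "g \<in> borel_measurable borel" using g by (rule borel_measurable_continuous_onI)
    have "integral\<^sup>L \<mu> g = (\<integral>t. g (h' t) \<partial>M)"
      unfolding \<mu>_def using M' h'_meas g_meas by (rule integral_distr_borel)
    also have "\<dots> = integral\<^sup>L M G"
    proof (rule integral_cong_AE)
      show "(\<lambda>t. g (h' t)) \<in> borel_measurable M"
        using measurable_compose[OF h'_meas g_meas] by (simp cong: measurable_cong_sets)
      show "G \<in> borel_measurable M"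
        using borel_measurable_continuous_onI[OF G(1)] by (simp cong: measurable_cong_sets)
      show "AE t in M. g (h' t) = G t"
        using AE_K by eventually_elim (simp add: h'_def G(2))
    qed
    finally have "(\<lambda>n. \<integral>x. G (s x) \<partial>P (r n)) \<longlonglongrightarrow> integral\<^sup>L \<mu> g"
      using lim[OF G(1), of B] G(3) by simp
    then have sub: "((\<lambda>n. integral\<^sup>L (P n) g) \<circ> r) \<longlonglongrightarrow> integral\<^sup>L \<mu> g"
      by (simp add: G(2) sK h(2) o_def)
    \<comment> \<open>The full sequence has some limit, and the subsequence \<open>r\<close>
      identifies it.\<close>
    obtain L where L: "(\<lambda>n. integral\<^sup>L (P n) g) \<longlonglongrightarrow> L"
      using conv[OF g] by (auto simp: convergent_def)
    then show ?thesis
      using LIMSEQ_unique[OF LIMSEQ_subseq_LIMSEQ[OF L r] sub] by simp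
  qed
  with \<mu> show ?thesis by (rule that)
qed

section \<open>Statistical points\<close>

lemma continuous_map_weak_star_integral:
  fixes g :: "'a::topological_space \<Rightarrow> real"
  assumes "continuous_on UNIV g"
  shows "continuous_map weak_star euclideanreal (\<lambda>\<mu>. integral\<^sup>L \<mu> g)"
proof -
  let ?C = "{g::'a \<Rightarrow> real. continuous_on UNIV g}"
  have "continuous_map weak_star euclideanreal ((\<lambda>h. h g) \<circ> (\<lambda>\<mu>. \<lambda>g\<in>?C. integral\<^sup>L \<mu> g))"
    unfolding weak_star_def
    by (rule continuous_map_pullback, rule continuous_map_product_projection) (use assms in simp)
  then show ?thesis
    using assms by (simp add: o_def)
qed

text \<open>If the values differed, disjoint neighbourhoods would put \<open>F (s n)\<close>
  infinitely often in one and eventually always in the other.\<close>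

lemma accumulation_point_limit_eq:
  fixes F :: "'b \<Rightarrow> 'c::metric_space"
  assumes "\<mu> \<in> accumulation_points X s" "continuous_map X euclidean F" "(\<lambda>n. F (s n)) \<longlonglongrightarrow> L"
  shows "F \<mu> = L"
proof (rule ccontr)
  assume "F \<mu> \<noteq> L"
  then obtain U V where UV: "open U" "open V" "F \<mu> \<in> U" "L \<in> V" "U \<inter> V = {}"
    using hausdorff[of "F \<mu>" L] by auto
  have "openin X {x \<in> topspace X. F x \<in> U}"
    using assms(2) UV(1) by (auto simp: continuous_map_def)
  then have "\<exists>\<^sub>F n in sequentially. s n \<in> {x \<in> topspace X. F x \<in> U}"
    using assms(1) UV(3) by (auto simp: accumulation_points_def)
  moreover have "\<forall>\<^sub>F n in sequentially. F (s n) \<in> V"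
    using UV(2,4) by (rule topological_tendstoD[OF assms(3)])
  then have "\<forall>\<^sub>F n in sequentially. s n \<notin> {x \<in> topspace X. F x \<in> U}"
    by eventually_elim (use UV(5) in auto)
  ultimately show False
    by (simp add: frequently_def)
qed

section \<open>Birkhoff averages and measurability of the set of statistical points\<close>

definition birkhoff_average :: "('a \<Rightarrow> 'a) \<Rightarrow> ('a \<Rightarrow> real) \<Rightarrow> nat \<Rightarrow> 'a \<Rightarrow> real" where
  "birkhoff_average f g n x = (\<Sum>i<n. g ((f ^^ i) x)) / real n"

lemma birkhoff_average_bound:
  assumes "\<And>x. \<bar>g x\<bar> \<le> B"
  shows "\<bar>birkhoff_average f g n x\<bar> \<le> B"
proof (cases "n = 0")
  case True
  then show ?thesis
    using order_trans[OF abs_ge_zero assms] by (simp add: birkhoff_average_def)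
next
  case False
  have "\<bar>\<Sum>i<n. g ((f ^^ i) x)\<bar> \<le> real n * B"
    using sum_norm_bound[of "{..<n}" "\<lambda>i. g ((f ^^ i) x)" B] assms by simp
  then show ?thesis
    using False by (simp add: birkhoff_average_def pos_divide_le_eq mult.commute)
qed

lemma birkhoff_average_diff:
  "birkhoff_average f (\<lambda>x. g x - d x) n x = birkhoff_average f g n x - birkhoff_average f d n x"
  by (simp add: birkhoff_average_def sum_subtractf diff_divide_distrib)

lemma continuous_on_funpow:
  fixes f :: "'a::topological_space \<Rightarrow> 'a"
  assumes "continuous_on UNIV f"
  shows "continuous_on UNIV (f ^^ n)"
proof (induction n)
  case (Suc n)
  then show ?case
    using continuous_on_compose2[OF assms Suc] by (simp add: o_def)
qed simp

lemma continuous_on_birkhoff_average: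
  assumes "continuous_on UNIV f" "continuous_on UNIV g"
  shows "continuous_on UNIV (birkhoff_average f g n)"
proof (cases "n = 0")
  case True
  then show ?thesis by (simp add: birkhoff_average_def[abs_def])
next
  case False
  have "continuous_on UNIV (\<lambda>x. g ((f ^^ i) x))" for i
    using continuous_on_compose2[OF assms(2) continuous_on_funpow[OF assms(1)]] by simp
  then show ?thesis
    unfolding birkhoff_average_def[abs_def] using False by (intro continuous_intros) auto
qed

text \<open>This eliminates the unknown limit measure from the definition, leaving convergence of
  real sequences. The nontrivial direction builds that measure with
  \<open>convergent_integrals_imp_limit_measure\<close>.\<close>

lemma mem_statistical_points_iff:
  fixes f :: "'a::{t2_space,second_countable_topology} \<Rightarrow> 'a"
  assumes "compact (UNIV :: 'a set)"
  shows "x \<in> statistical_points f \<longleftrightarrow>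
    (\<forall>g. continuous_on UNIV g \<longrightarrow> convergent (\<lambda>n. birkhoff_average f g n x))"
proof -
  \<comment> \<open>Indices start at 1, since the empirical measure at 0 is not a probability
    measure; limits are unaffected by the shift.\<close>
  have P: "empirical_measure f (Suc n) x \<in> borel_prob_measures" for n
    unfolding empirical_measure_def by (rule cesaro_mean_in_borel_prob_measures) simp_all
  then have ev: "\<forall>\<^sub>F n in sequentially. empirical_measure f n x \<in> borel_prob_measures"
    by (subst eventually_sequentially_Suc[symmetric]) simp
  have int: "integral\<^sup>L (empirical_measure f (Suc n) x) g = birkhoff_average f g (Suc n) x"
    if g: "continuous_on UNIV g" for g n
  proof -
    obtain B where "\<And>x. \<bar>g x\<bar> \<le> B"
      using continuous_on_compact_UNIV_bounded[OF assms g] by blast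
    then show ?thesis
      unfolding birkhoff_average_def using borel_measurable_continuous_onI[OF g]
      by (intro integral_empirical_measure) auto
  qed
  have lim: "(\<lambda>n. integral\<^sup>L (empirical_measure f n x) g) \<longlonglongrightarrow> L \<longleftrightarrow>
      (\<lambda>n. birkhoff_average f g n x) \<longlonglongrightarrow> L"
    if "continuous_on UNIV g" for g L
    using int[OF that]
      filterlim_sequentially_Suc[of "\<lambda>n. integral\<^sup>L (empirical_measure f n x) g" "nhds L"]
      filterlim_sequentially_Suc[of "\<lambda>n. birkhoff_average f g n x" "nhds L"] by simp
  show ?thesis
  proof
    assume "x \<in> statistical_points f"
    then obtain \<mu> where "limitin weak_star (\<lambda>n. empirical_measure f n x) \<mu> sequentially"
      by (auto simp: statistical_points_def)
    from limitin_weak_star_imp_integral[OF this]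
    show "\<forall>g. continuous_on UNIV g \<longrightarrow> convergent (\<lambda>n. birkhoff_average f g n x)"
      by (auto simp: lim intro!: convergentI)
  next
    assume R: "\<forall>g. continuous_on UNIV g \<longrightarrow> convergent (\<lambda>n. birkhoff_average f g n x)"
    have "convergent (\<lambda>n. integral\<^sup>L (empirical_measure f (Suc n) x) g)"
      if g: "continuous_on UNIV g" for g :: "'a \<Rightarrow> real"
    proof -
      have "convergent (\<lambda>n. birkhoff_average f g (Suc n) x)"
        using R g convergent_Suc_iff[of "\<lambda>n. birkhoff_average f g n x"] by simp
      then show ?thesis by (simp add: int[OF g])
    qed
    then obtain \<mu> where \<mu>: "\<mu> \<in> borel_prob_measures" "\<And>g::'a \<Rightarrow> real. continuous_on UNIV g \<Longrightarrow>
        (\<lambda>n. integral\<^sup>L (empirical_measure f (Suc n) x) g) \<longlonglongrightarrow> integral\<^sup>L \<mu> g"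
      using convergent_integrals_imp_limit_measure[OF assms, of "\<lambda>n. empirical_measure f (Suc n) x"] P
      by metis
    have "limitin weak_star (\<lambda>n. empirical_measure f n x) \<mu> sequentially"
      unfolding limitin_weak_star_iff[OF ev]
    proof (intro conjI allI impI)
      fix g :: "'a \<Rightarrow> real" assume "continuous_on UNIV g"
      from \<mu>(2)[OF this] show "(\<lambda>n. integral\<^sup>L (empirical_measure f n x) g) \<longlonglongrightarrow> integral\<^sup>L \<mu> g"
        by (rule LIMSEQ_imp_Suc)
    qed (rule \<mu>(1))
    then show "x \<in> statistical_points f"
      by (auto simp: statistical_points_def)
  qed
qed

text \<open>A uniformly small change of the observable changes all its averages by no more,
  uniformly in \<open>n\<close>, so the Cauchy property passes to \<open>g\<close> by splitting
  \<open>e\<close> into thirds.\<close>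

lemma convergent_birkhoff_average_approx:
  assumes "\<And>e. e > 0 \<Longrightarrow> \<exists>d\<in>D. \<forall>x. \<bar>g x - d x\<bar> < e"
    and "\<And>d. d \<in> D \<Longrightarrow> convergent (\<lambda>n. birkhoff_average f d n x)"
  shows "convergent (\<lambda>n. birkhoff_average f g n x)"
proof -
  have "Cauchy (\<lambda>n. birkhoff_average f g n x)"
  proof (rule metric_CauchyI)
    fix e :: real assume "e > 0"
    then obtain d where d: "d \<in> D" "\<And>x. \<bar>g x - d x\<bar> < e / 3"
      using assms(1)[of "e / 3"] by auto
    have near: "\<bar>birkhoff_average f g n x - birkhoff_average f d n x\<bar> \<le> e / 3" for n
      using birkhoff_average_bound[of "\<lambda>x. g x - d x" "e / 3" f n x] d(2)
      by (simp add: birkhoff_average_diff less_imp_le)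
    obtain N where N: "\<And>m n. m \<ge> N \<Longrightarrow> n \<ge> N \<Longrightarrow>
        dist (birkhoff_average f d m x) (birkhoff_average f d n x) < e / 3"
      using metric_CauchyD[OF convergent_Cauchy[OF assms(2)[OF d(1)]], of "e / 3"] \<open>e > 0\<close> by auto
    have "dist (birkhoff_average f g m x) (birkhoff_average f g n x) < e"
      if "m \<ge> N" "n \<ge> N" for m n
      using N[OF that] near[of m] near[of n] unfolding dist_real_def by linarith
    then show "\<exists>N. \<forall>m\<ge>N. \<forall>n\<ge>N. dist (birkhoff_average f g m x) (birkhoff_average f g n x) < e"
      by blast
  qed
  then show ?thesis by (rule Cauchy_convergent)
qed

text \<open>Uniform approximation reduces the convergence condition to a countable family D of
  continuous observables, so the set is a countable intersection of Borel convergence sets.\<close>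

lemma statistical_points_borel:
  fixes f :: "'a::{t2_space,second_countable_topology} \<Rightarrow> 'a"
  assumes "compact (UNIV :: 'a set)" "continuous_on UNIV f"
  shows "statistical_points f \<in> sets borel"
proof -
  obtain D :: "('a \<Rightarrow> real) set" where D: "countable D" "\<And>d. d \<in> D \<Longrightarrow> continuous_on UNIV d"
    "\<And>g e. continuous_on UNIV g \<Longrightarrow> e > 0 \<Longrightarrow> \<exists>d\<in>D. \<forall>x. \<bar>g x - d x\<bar> < e"
    using ex_countable_dense_continuous[OF assms(1)] by metis
  have "statistical_points f = {x. \<forall>d\<in>D. convergent (\<lambda>n. birkhoff_average f d n x)}"
  proof (intro set_eqI iffI)
    fix x assume "x \<in> {x. \<forall>d\<in>D. convergent (\<lambda>n. birkhoff_average f d n x)}"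
    then show "x \<in> statistical_points f"
      unfolding mem_statistical_points_iff[OF assms(1)]
      using convergent_birkhoff_average_approx[of D _ f x] D(3) by auto
  qed (use D(2) mem_statistical_points_iff[OF assms(1), of _ f] in auto)
  also have "\<dots> = (\<Inter>d\<in>D. {x. convergent (\<lambda>n. birkhoff_average f d n x)})"
    by auto
  also have "\<dots> \<in> sets borel"
  proof (cases "D = {}")
    case False
    have "{x. convergent (\<lambda>n. birkhoff_average f d n x)} \<in> sets borel" if "d \<in> D" for d
      using sets_Collect_Cauchy[of "birkhoff_average f d" borel]
        borel_measurable_continuous_onI[OF continuous_on_birkhoff_average[OF assms(2) D(2)[OF that]]]
      by (simp add: Cauchy_convergent_iff)
    then show ?thesis
      using D(1) False by (intro sets.countable_INT') auto
  qed simp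
  finally show ?thesis .
qed

section \<open>Averaged push-forwards and their accumulation points\<close>

theorem theorem1:
  fixes \<A> :: "('a::{t2_space,second_countable_topology} set \<times> ('a \<Rightarrow> 'e::euclidean_space)) set"
    and m :: "'a measure"
    and f :: "'a \<Rightarrow> 'a"
  assumes "smooth_atlas \<A>"
    and "compact (UNIV :: 'a set)"
    and "connected (UNIV :: 'a set)"
    and "normalized_volume_measure \<A> m"
    and "continuous_on UNIV f"
    and "minimal_oscillation m f"
  shows "nonstatistical m f"
proof (rule ccontr)
  assume "\<not> nonstatistical m f"
  then have null: "emeasure m (nonstatistical_points f) = 0"
    by (simp add: nonstatistical_def)
  have m: "m \<in> borel_prob_measures"
    using assms(4) by (simp add: normalized_volume_measure_def smooth_volume_measure_def borel_prob_measures_def)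
  then interpret prob_space m by (simp add: borel_prob_measures_def)
  have sets_m [measurable_cong]: "sets m = sets borel"
    using m by (simp add: borel_prob_measures_def)
  have f_meas: "f ^^ i \<in> borel_measurable borel" for i
    using continuous_on_funpow[OF assms(5)] by (rule borel_measurable_continuous_onI)
  \<comment> \<open>The value 0 of \<open>emeasure\<close> alone would also fit a non-measurable
    set; Borel measurability turns it into a genuine null set.\<close>
  have "nonstatistical_points f \<in> null_sets m"
    using null statistical_points_borel[OF assms(2,5)] sets_m
    by (auto simp: nonstatistical_points_def)
  then have AE_stat: "AE x in m. x \<in> statistical_points f"
    using AE_not_in by (fastforce simp: nonstatistical_points_def)
  let ?s = "cesaro_mean (\<lambda>i. distr m borel (f ^^ i))"
  have conv: "convergent (\<lambda>n. integral\<^sup>L (?s n) g)" if g: "continuous_on UNIV g" for g :: "'a \<Rightarrow> real"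
  proof -
    obtain B where B: "\<And>x. \<bar>g x\<bar> \<le> B"
      using continuous_on_compact_UNIV_bounded[OF assms(2) g] by blast
    have g_meas: "g \<in> borel_measurable borel" using g by (rule borel_measurable_continuous_onI)
    have meas: "birkhoff_average f g n \<in> borel_measurable m" for n
      using borel_measurable_continuous_onI[OF continuous_on_birkhoff_average[OF assms(5) g]]
      by (simp cong: measurable_cong_sets add: sets_m)
    have gf_int: "integrable m (\<lambda>x. g ((f ^^ i) x))" for i
      using measurable_compose[OF f_meas g_meas] B
      by (intro integrable_const_bound[of _ B]) (auto cong: measurable_cong_sets simp: sets_m)
    \<comment> \<open>By change of variables, integrating \<open>g\<close> against the averaged
      push-forward is integrating its Birkhoff average against \<open>m\<close>.\<close>
    have eq: "integral\<^sup>L (?s (Suc n)) g = integral\<^sup>L m (birkhoff_average f g (Suc n))" for n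
    proof -
      have "integral\<^sup>L (?s (Suc n)) g
          = (\<Sum>i<Suc n. integral\<^sup>L (distr m borel (f ^^ i)) g) / real (Suc n)"
        using borel_prob_measures_distr[OF m f_meas] g_meas B by (intro integral_cesaro_mean) auto
      also have "\<dots> = integral\<^sup>L m (birkhoff_average f g (Suc n))"
        using gf_int integral_distr_borel[OF m f_meas g_meas]
        by (simp add: birkhoff_average_def[abs_def])
      finally show ?thesis .
    qed
    \<comment> \<open>Almost every point is statistical, so the averages converge almost everywhere,
      and they are bounded by B. The value of \<open>lim\<close> at the remaining points is
      arbitrary but carries no mass.\<close>
    have "(\<lambda>n. integral\<^sup>L m (birkhoff_average f g n)) \<longlonglongrightarrow>
        (\<integral>x. lim (\<lambda>n. birkhoff_average f g n x) \<partial>m)"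
    proof (rule integral_dominated_convergence[where w="\<lambda>_. B"])
      show "(\<lambda>x. lim (\<lambda>n. birkhoff_average f g n x)) \<in> borel_measurable m"
        using meas by (rule borel_measurable_lim_metric)
      show "AE x in m. (\<lambda>n. birkhoff_average f g n x) \<longlonglongrightarrow> lim (\<lambda>n. birkhoff_average f g n x)"
        using AE_stat
        by eventually_elim (use g in \<open>auto simp: mem_statistical_points_iff[OF assms(2)] convergent_LIMSEQ_iff\<close>)
    qed (use meas birkhoff_average_bound[where g=g, OF B] in auto)
    then have "convergent (\<lambda>n. integral\<^sup>L m (birkhoff_average f g n))"
      by (rule convergentI)
    then have "convergent (\<lambda>n. integral\<^sup>L (?s (Suc n)) g)"
      unfolding eq using convergent_Suc_iff[of "\<lambda>n. integral\<^sup>L m (birkhoff_average f g n)"] by simp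
    then show ?thesis
      using convergent_Suc_iff[of "\<lambda>n. integral\<^sup>L (?s n) g"] by simp
  qed
  obtain \<mu> \<nu> where acc: "\<mu> \<noteq> \<nu>" "\<mu> \<in> accumulation_points weak_star ?s"
      "\<nu> \<in> accumulation_points weak_star ?s"
    using assms(6) by (auto simp: minimal_oscillation_def)
  \<comment> \<open>Both integrals equal the limit of the integrals of \<open>g\<close> along the
    sequence, as integration of \<open>g\<close> is weak* continuous.\<close>
  have "integral\<^sup>L \<mu> g = integral\<^sup>L \<nu> g" if g: "continuous_on UNIV g" for g :: "'a \<Rightarrow> real"
  proof -
    obtain L where "(\<lambda>n. integral\<^sup>L (?s n) g) \<longlonglongrightarrow> L"
      using conv[OF g] by (auto simp: convergent_def)
    from accumulation_point_limit_eq[OF acc(2) continuous_map_weak_star_integral[OF g] this]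
      accumulation_point_limit_eq[OF acc(3) continuous_map_weak_star_integral[OF g] this]
    show ?thesis by simp
  qed
  moreover have "\<mu> \<in> borel_prob_measures" "\<nu> \<in> borel_prob_measures"
    using acc by (auto simp: accumulation_points_def)
  ultimately have "\<mu> = \<nu>"
    using borel_prob_measures_eqI[OF assms(2)] by metis
  with acc(1) show False by simp
qed

end
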